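(* Consider the non-stationary $N$-armed stochastic bandit problem (described in the context) in an abruptly-changing environment in which the number of breakpoints up to time $T$ satisfies $\Upsilon_T\le C\,T^{\nu}$ for some constant $C>0$ and some known $\nu\in[0,1)$, and assume $\Delta_{\min}>0$. Run the SW-UCB\# algorithm with $\alpha=\frac{1-\nu}{2}$ and any fixed $\lambda>0$. Then the expected cumulative regret satisfies \[ R^{\text{SW-UCB\#}}(T)\in O\big(T^{\frac{1+\nu}{2}}\ln T\big)\quad\text{as }T\to\infty. \]
   Context: Non-stationary stochastic MAB: there are $N$ arms. At each time $t\in\{1,\dots,T\}$ the decision-maker picks an arm $j_t$ and receives a reward $r_t$ drawn (independently of the past, given the chosen arm and time) from a distribution supported on $[0,1]$ with mean $\mu_{j_t}(t)\in[0,1]$; the means $\mu_j(t)$ are unknown and may depend on $t$. Let $\mu_{j_t^*}(t)=\max_{j}\mu_j(t)$. The expected cumulative regret of a policy is $R(T)=\sum_{t=1}^T \mathbb{E}[\mu_{j_t^*}(t)-\mu_{j_t}(t)]$, the expectation being over the randomness of the chosen arms. Abruptly-changing environment: the mean vector $(\mu_1(t),\dots,\mu_N(t))$ is piecewise constant in $t$; a time at which it changes is a breakpoint, and $\Upsilon_T$ denotes the number of breakpoints up to time $T$. Define $\Delta_{\min}=\min\{\mu_{j_t^*}(t)-\mu_j(t) : t\in\{1,\dots,T\},\ j\ne j_t^*\}$. SW-UCB\# algorithm (parameters $\alpha\in(0,1]$, $\lambda>0$): the sliding-window width at time $t$ is $\tau(t,\alpha)=\min\{\lceil\lambda t^\alpha\rceil,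 t\}$. Let $n_j(t,\alpha)=\sum_{s=t-\tau(t,\alpha)+1}^{t}\mathbf 1_{\{j_s=j\}}$ and $\bar r_j(t,\alpha)=\frac{1}{n_j(t,\alpha)}\sum_{s=t-\tau(t,\alpha)+1}^{t} r_s\mathbf 1_{\{j_s=j\}}$, and $c_j(t,\alpha)=\sqrt{(1+\alpha)\ln t/n_j(t,\alpha)}$ (with the index $\bar r_j+c_j$ taken to be $+\infty$ if $n_j(t,\alpha)=0$). For $t=1,\dots,N$ the algorithm plays arm $j_t=t$; for $t>N$ it plays $j_t\in\arg\max_{j}\{\bar r_j(t-1,\alpha)+c_j(t-1,\alpha)\}$ (ties broken arbitrarily). The hidden constant in the $O(\cdot)$ may depend on $N,\nu,C,\lambda,\Delta_{\min}$ but not on $T$. *)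

theory Defs
  imports "HOL-Probability.Probability"
begin

text \<open>Arms are 0,...,N-1 (arm j here is arm j+1 of the paper); times are 1,2,....
  A realisation of all potential rewards is w :: nat * nat => real, w (j,t) being the
  reward that arm j would yield at time t. These are independent with law D j t.\<close>

definition sw_width :: "real \<Rightarrow> real \<Rightarrow> nat \<Rightarrow> nat" where
  "sw_width lam alpha t = min (nat \<lceil>lam * real t powr alpha\<rceil>) t"

definition swucb_index ::
  "real \<Rightarrow> real \<Rightarrow> (nat \<Rightarrow> nat) \<Rightarrow> (nat \<Rightarrow> real) \<Rightarrow> nat \<Rightarrow> nat \<Rightarrow> ereal" where
  "swucb_index lam alpha js rs t j =
     (let S = {s \<in> {t - sw_width lam alpha t + 1..t}. js s = j}; n = card S
      in if n = 0 then PInfty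
         else ereal ((\<Sum>s\<in>S. rs s) / real n + sqrt ((1 + alpha) * ln (real t) / real n)))"

text \<open>List of arms played at times 1..t (entry s-1 is the arm played at time s).
  sel is the tie-breaking rule: it gets the time, the history of (arm, reward) pairs
  and the set of maximisers of the index.\<close>
fun sw_hist ::
  "nat \<Rightarrow> real \<Rightarrow> real \<Rightarrow> (nat \<Rightarrow> (nat \<times> real) list \<Rightarrow> nat set \<Rightarrow> nat)
     \<Rightarrow> (nat \<times> nat \<Rightarrow> real) \<Rightarrow> nat \<Rightarrow> nat list" where
  "sw_hist N lam alpha sel w 0 = []"
| "sw_hist N lam alpha sel w (Suc t) =
     (let h = sw_hist N lam alpha sel w t;
          js = (\<lambda>s. h ! (s - 1));
          rs = (\<lambda>s. w (js s, s))
      in h @ [if Suc t \<le> N then t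
              else sel (Suc t) (map (\<lambda>s. (js s, rs s)) [1..<Suc t])
                     {j. j < N \<and> (\<forall>k<N. swucb_index lam alpha js rs t k
                                         \<le> swucb_index lam alpha js rs t j)}])"

definition sw_arm ::
  "nat \<Rightarrow> real \<Rightarrow> real \<Rightarrow> (nat \<Rightarrow> (nat \<times> real) list \<Rightarrow> nat set \<Rightarrow> nat)
     \<Rightarrow> (nat \<times> nat \<Rightarrow> real) \<Rightarrow> nat \<Rightarrow> nat" where
  "sw_arm N lam alpha sel w t = sw_hist N lam alpha sel w t ! (t - 1)"

definition reward_space :: "nat \<Rightarrow> (nat \<Rightarrow> nat \<Rightarrow> real measure) \<Rightarrow> (nat \<times> nat \<Rightarrow> real) measure" where
  "reward_space N D = PiM ({..<N} \<times> UNIV) (\<lambda>(j, t). D j t)"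

definition arm_mean :: "(nat \<Rightarrow> nat \<Rightarrow> real measure) \<Rightarrow> nat \<Rightarrow> nat \<Rightarrow> real" where
  "arm_mean D j t = integral\<^sup>L (D j t) (\<lambda>x. x)"

definition num_breakpoints :: "nat \<Rightarrow> (nat \<Rightarrow> nat \<Rightarrow> real) \<Rightarrow> nat \<Rightarrow> nat" where
  "num_breakpoints N mu T = card {t \<in> {2..T}. \<exists>j<N. mu j t \<noteq> mu j (t - 1)}"

definition sw_regret ::
  "nat \<Rightarrow> real \<Rightarrow> real \<Rightarrow> (nat \<Rightarrow> (nat \<times> real) list \<Rightarrow> nat set \<Rightarrow> nat)
     \<Rightarrow> (nat \<Rightarrow> nat \<Rightarrow> real measure) \<Rightarrow> nat \<Rightarrow> real" where
  "sw_regret N lam alpha sel D T =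
     (\<Sum>t=1..T. integral\<^sup>L (reward_space N D)
        (\<lambda>w. Max {arm_mean D k t | k. k < N} - arm_mean D (sw_arm N lam alpha sel w t) t))"

end

theory Submission
  imports Defs
begin

text \<open>Every round has regret at most 1, and it has regret 0 unless one of four things happens: the
  round is one of the first \<open>N\<close>; the means change within the current window; some windowed sample mean
  is farther from its expectation than the confidence radius; or the suboptimal arm played has at
  most \<open>L = 4 (1 + alpha) ln T / Delta\<^sup>2\<close> samples in the window. Each breakpoint spoils at most one
  window length of rounds, which gives \<open>O(T powr (nu + alpha))\<close>. Deviations have probability
  \<open>O(1 / t)\<close>, by a Chernoff bound for a supermartingale and a union bound over the number of samples.
  Rounds of the last kind are sparse, since a window before such a round contains at most \<open>L\<close> of them;
  as windows have length about \<open>lam * t powr alpha\<close>, there are \<open>O(L * T powr (1 - alpha))\<close>.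
  The choice \<open>alpha = (1 - nu) / 2\<close> makes \<open>nu + alpha = 1 - alpha = (1 + nu) / 2\<close>.\<close>

subsection \<open>Independence in product spaces and Hoeffding's lemma\<close>

text \<open>Independence means that the joint law is the product of the marginals. Here the joint
  map is the identity on the space, and the marginal at \<open>i\<close> is
  \<open>M i\<close>.\<close>

lemma indep_vars_PiM_components:
  assumes "I \<noteq> {}" and prob: "\<And>i. i \<in> I \<Longrightarrow> prob_space (M i)"
  shows "prob_space.indep_vars (PiM I M) M (\<lambda>i w. w i) I"
proof -
  interpret prob_space "PiM I M" by (intro prob_space_PiM prob)
  have "distr (PiM I M) (PiM I M) (\<lambda>w. \<lambda>i\<in>I. w i) = distr (PiM I M) (PiM I M) (\<lambda>w. w)"
    by (intro distr_cong) (auto simp: space_PiM PiE_restrict)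
  also have "\<dots> = PiM I (\<lambda>i. distr (PiM I M) (M i) (\<lambda>w. w i))"
    by (simp add: distr_id2) (intro PiM_cong refl distr_PiM_component[symmetric] prob)
  finally show ?thesis
    using \<open>I \<noteq> {}\<close> by (subst indep_vars_iff_distr_eq_PiM') auto
qed

text \<open>A function of the coordinates in \<open>J\<close> is independent of coordinate
  \<open>i\<close>, so the expectation factorises. In the supermartingale argument \<open>J\<close>
  holds the past rewards and \<open>i\<close> is the current one.\<close>

lemma integral_PiM_mult_component:
  fixes f :: "('i \<Rightarrow> 'a) \<Rightarrow> real" and g :: "'a \<Rightarrow> real"
  assumes prob: "\<And>i. i \<in> I \<Longrightarrow> prob_space (M i)"
    and "J \<subseteq> I" "i \<in> I - J"
    and f: "integrable (PiM I M) f" and g: "integrable (M i) g"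
    and local: "\<And>w w'. w \<in> space (PiM I M) \<Longrightarrow> w' \<in> space (PiM I M) \<Longrightarrow>
                  (\<And>k. k \<in> J \<Longrightarrow> w k = w' k) \<Longrightarrow> f w = f w'"
  shows "(\<integral>w. f w * g (w i) \<partial>PiM I M) = (\<integral>w. f w \<partial>PiM I M) * (\<integral>x. g x \<partial>M i)"
    and "integrable (PiM I M) (\<lambda>w. f w * g (w i))"
proof -
  interpret prob_space "PiM I M" by (intro prob_space_PiM prob)
  obtain z where z: "z \<in> space (PiM I M)"
    using not_empty by blast
  \<comment> \<open>Coordinates outside \<open>J\<close> are filled in from the fixed point
    \<open>z\<close>. Thus \<open>f\<close> composed with \<open>ext\<close> lives on
    \<open>PiM J M\<close>, where independence of coordinate blocks applies, and
    \<open>f_ext\<close> recovers \<open>f\<close>.\<close>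
  define ext where "ext = (\<lambda>v. \<lambda>k\<in>I. if k \<in> J then v k else z k)"
  have z_k: "z k \<in> space (M k)" if "k \<in> I" for k
    using z that by (auto simp: space_PiM)
  have ext [measurable]: "ext \<in> PiM J M \<rightarrow>\<^sub>M PiM I M"
    unfolding ext_def
  proof (rule measurable_restrict)
    fix k assume "k \<in> I"
    then show "(\<lambda>v. if k \<in> J then v k else z k) \<in> PiM J M \<rightarrow>\<^sub>M M k"
      using z_k by (cases "k \<in> J") auto
  qed
  have f_ext: "f (ext (restrict w J)) = f w" if w: "w \<in> space (PiM I M)" for w
  proof (rule local)
    have "restrict w J \<in> space (PiM J M)"
      using w \<open>J \<subseteq> I\<close> by (auto simp: space_PiM)
    then show "ext (restrict w J) \<in> space (PiM I M)"
      by (rule measurable_space[OF ext])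
  qed (use w \<open>J \<subseteq> I\<close> in \<open>auto simp: ext_def\<close>)
  have [measurable]: "f \<in> borel_measurable (PiM I M)" "g \<in> borel_measurable (M i)"
    using f g by auto
  have indep: "indep_var borel ((\<lambda>v. f (ext v)) \<circ> (\<lambda>w. restrict (\<lambda>k. w k) J))
      borel ((\<lambda>v. g (v i)) \<circ> (\<lambda>w. restrict (\<lambda>k. w k) {i}))"
    using \<open>J \<subseteq> I\<close> \<open>i \<in> I - J\<close>
    by (intro indep_var_compose[OF indep_var_restrict[OF indep_vars_PiM_components]] prob) auto
  have int_f: "integrable (PiM I M) ((\<lambda>v. f (ext v)) \<circ> (\<lambda>w. restrict (\<lambda>k. w k) J))"
    using f f_ext by (subst Bochner_Integration.integrable_cong[where g = f]) auto
  have distr_i: "distr (PiM I M) (M i) (\<lambda>w. w i) = M i"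
    using \<open>i \<in> I - J\<close> by (intro distr_PiM_component prob) auto
  have i: "i \<in> I" using \<open>i \<in> I - J\<close> by auto
  have int_g: "integrable (PiM I M) (\<lambda>w. g (w i))"
    using g by (subst (asm) distr_i[symmetric]) (simp add: integrable_distr_eq i)
  have eq_g: "(\<integral>w. g (w i) \<partial>PiM I M) = (\<integral>x. g x \<partial>M i)"
    using integral_distr[of "\<lambda>w. w i" "PiM I M" "M i" g] by (simp add: distr_i i)
  have eq_f: "(\<integral>w. f (ext (restrict w J)) \<partial>PiM I M) = (\<integral>w. f w \<partial>PiM I M)"
    by (intro Bochner_Integration.integral_cong refl f_ext)
  have eq_fg: "(\<integral>w. f (ext (restrict w J)) * g (w i) \<partial>PiM I M) = (\<integral>w. f w * g (w i) \<partial>PiM I M)"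
    by (intro Bochner_Integration.integral_cong refl arg_cong2[where f = "(*)"] f_ext)
  show "(\<integral>w. f w * g (w i) \<partial>PiM I M) = (\<integral>w. f w \<partial>PiM I M) * (\<integral>x. g x \<partial>M i)"
    using indep_var_lebesgue_integral[OF indep int_f] int_g by (simp add: o_def eq_f eq_g eq_fg)
  show "integrable (PiM I M) (\<lambda>w. f w * g (w i))"
    using indep_var_integrable[OF indep int_f] int_g
    by (simp add: o_def f_ext cong: Bochner_Integration.integrable_cong)
qed

text \<open>For \<open>h > 0\<close> this is Hoeffding's lemma on an interval of length 1. Negative
  \<open>h\<close> reduces to it through \<open>- X\<close>, which lies in \<open>{-1..0}\<close>.
  The term \<open>h\<^sup>2 / 8\<close> sits inside the exponential so that such factors multiply to
  a supermartingale.\<close>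

lemma (in prob_space) integral_exp_centered_le_1:
  fixes X :: "'a \<Rightarrow> real" and h :: real
  assumes X [measurable]: "random_variable borel X" and bounded: "AE x in M. X x \<in> {0..1}"
  shows "expectation (\<lambda>x. exp (h * (X x - expectation X) - h\<^sup>2 / 8)) \<le> 1"
proof -
  have pos: "expectation (\<lambda>x. exp (l * (Y x - expectation Y))) \<le> exp (l\<^sup>2 / 8)"
    if "l > 0" and [measurable]: "random_variable borel Y" and "AE x in M. Y x \<in> {b..b + 1}"
    for l b :: real and Y :: "'a \<Rightarrow> real"
  proof -
    interpret Y: interval_bounded_random_variable M Y b "b + 1"
      using that by unfold_locales auto
    have "(\<integral>\<^sup>+x. exp (l * (Y x - expectation Y)) \<partial>M) \<le> ennreal (exp (l\<^sup>2 / 8))"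
      using Y.Hoeffdings_lemma_nn_integral[OF \<open>l > 0\<close>] by simp
    then show ?thesis
      by (subst integral_eq_nn_integral) (auto intro: enn2real_leI)
  qed
  have "expectation (\<lambda>x. exp (h * (X x - expectation X))) \<le> exp (h\<^sup>2 / 8)"
  proof (cases h "0 :: real" rule: linorder_cases)
    case less
    have "AE x in M. - X x \<in> {-1..-1 + 1}"
      using bounded by eventually_elim auto
    then have "expectation (\<lambda>x. exp (-h * (- X x - expectation (\<lambda>x. - X x)))) \<le> exp ((-h)\<^sup>2 / 8)"
      using less by (intro pos[of _ _ "-1"]) auto
    then show ?thesis
      by (simp add: algebra_simps)
  next
    case greater
    then show ?thesis
      using bounded by (intro pos[of _ _ 0]) auto
  qed (simp add: prob_space)
  then show ?thesis
    by (simp add: exp_diff)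
qed

subsection \<open>Window lengths and counting\<close>

text \<open>Tangent-line bound for a concave power, from Young's inequality
  \<open>u powr b * x powr (1 - b) \<le> b * u + (1 - b) * x\<close> multiplied by
  \<open>x powr (b - 1)\<close>.\<close>

lemma powr_diff_ge:
  fixes x u b :: real
  assumes "0 \<le> u" "0 < x" "0 < b" "b < 1"
  shows "b * x powr (b - 1) * (x - u) \<le> x powr b - u powr b"
proof -
  have x: "x powr (b - 1) * x = x powr b"
    using \<open>0 < x\<close> powr_mult_base[of x "b - 1"] by (simp add: mult.commute)
  have "u powr b * x powr (1 - b) \<le> b * u + (1 - b) * x"
  proof (cases "u = 0")
    case False
    then show ?thesis
      using assms by (intro Youngs_inequality_0) auto
  qed (use assms in auto)
  then have "u powr b * x powr (1 - b) * x powr (b - 1) \<le> (b * u + (1 - b) * x) * x powr (b - 1)"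
    by (intro mult_right_mono) auto
  moreover have "x powr (1 - b) * x powr (b - 1) = 1"
    using \<open>0 < x\<close> by (simp flip: powr_add)
  ultimately have "u powr b \<le> (b * u + (1 - b) * x) * x powr (b - 1)"
    by (simp add: mult.assoc)
  then show ?thesis
    by (simp add: algebra_simps x[symmetric])
qed

text \<open>The sequence \<open>harm n - ln n\<close> is decreasing and equals 1 at
  \<open>n = 1\<close>.\<close>

lemma sum_inverse_le_ln:
  assumes "n \<ge> 1"
  shows "(\<Sum>t = 1..n. 1 / real t) \<le> 1 + ln (real n)"
proof -
  have "harm n - ln (real n) \<le> harm 1 - ln (real 1)"
    using assms by (intro euler_mascheroni_sequence_decreasing) auto
  then show ?thesis
    by (simp add: harm_def divide_inverse)
qed

lemma sw_width_le: "sw_width lam alpha t \<le> t"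
  by (simp add: sw_width_def)

lemma sw_width_le_powr:
  assumes "lam > 0" "alpha \<ge> 0" "t \<le> T"
  shows "real (sw_width lam alpha t) \<le> lam * real T powr alpha + 1"
proof -
  have "real (sw_width lam alpha t) \<le> real (nat \<lceil>lam * real t powr alpha\<rceil>)"
    by (simp add: sw_width_def)
  also have "\<dots> \<le> lam * real t powr alpha + 1"
    using assms by (simp add: of_nat_nat)
  also have "\<dots> \<le> lam * real T powr alpha + 1"
    using assms by (intro add_right_mono mult_left_mono powr_mono2) auto
  finally show ?thesis .
qed

text \<open>The factor \<open>min lam 1\<close> serves both branches of the minimum in
  \<open>sw_width\<close>: for \<open>alpha \<le> 1\<close> also the cap \<open>t\<close> is at
  least \<open>t powr alpha\<close>.\<close>

lemma sw_width_ge: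
  assumes "t \<ge> 1" "alpha \<le> 1"
  shows "min lam 1 * real t powr alpha \<le> real (sw_width lam alpha t)"
proof -
  have "real t powr alpha \<le> real t"
    using assms powr_mono[of alpha 1 "real t"] by simp
  moreover have "min lam 1 * real t powr alpha \<le> 1 * real t powr alpha"
    by (intro mult_right_mono) auto
  ultimately have "min lam 1 * real t powr alpha \<le> real t"
    by linarith
  moreover have "min lam 1 * real t powr alpha \<le> lam * real t powr alpha"
    by (intro mult_right_mono) auto
  then have "min lam 1 * real t powr alpha \<le> real (nat \<lceil>lam * real t powr alpha\<rceil>)"
    using real_nat_ceiling_ge by (rule order_trans)
  ultimately show ?thesis
    by (simp add: sw_width_def min_def)
qed

text \<open>The potential \<open>t powr (1 - alpha)\<close> has slope of order
  \<open>t powr (- alpha)\<close>, and a window has length of order \<open>t powr alpha\<close>, so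
  cutting off a window costs a constant amount of potential. This is the gain required by
  \<open>card_sparse_le\<close>.\<close>

lemma powr_window_gain:
  assumes "lam > 0" "0 < alpha" "alpha \<le> 1 / 2" "t \<ge> 1"
  shows "real (t - sw_width lam alpha t) powr (1 - alpha) + min lam 1 / 4
           \<le> real (Suc t) powr (1 - alpha)"
proof -
  let ?u = "real (t - sw_width lam alpha t)" and ?x = "real (Suc t)"
  \<comment> \<open>Comparing \<open>t\<close> with \<open>Suc t\<close> loses a factor 1/2, as
    \<open>t / Suc t \<ge> 1 / 2\<close>. The other 1/2 in the constant 1/4 is the bound
    \<open>1 - alpha \<ge> 1 / 2\<close>.\<close>
  have "1 / 2 \<le> (1 / 2 :: real) powr alpha"
    using assms powr_mono'[of alpha 1 "1/2"] by simp
  also have "\<dots> \<le> (real t / ?x) powr alpha"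
    using assms by (intro powr_mono2) (auto simp: field_simps)
  also have "\<dots> = real t powr alpha * ?x powr (- alpha)"
    by (simp add: powr_divide powr_minus divide_simps)
  finally have half: "1 / 2 \<le> real t powr alpha * ?x powr (- alpha)" .
  have "1 / 2 * (min lam 1 * (1 / 2)) \<le> (1 - alpha) * (min lam 1 * (real t powr alpha * ?x powr (- alpha)))"
    using assms half by (intro mult_mono) auto
  also have "\<dots> = (1 - alpha) * ?x powr (- alpha) * (min lam 1 * real t powr alpha)"
    by (simp add: mult_ac)
  also have "min lam 1 * real t powr alpha \<le> ?x - ?u"
    using sw_width_ge[of t alpha lam] sw_width_le[of lam alpha t] assms by (simp add: of_nat_diff)
  also have "(1 - alpha) * ?x powr (- alpha) * (?x - ?u) \<le> ?x powr (1 - alpha) - ?u powr (1 - alpha)"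
    using powr_diff_ge[of ?u ?x "1 - alpha"] assms by simp
  finally show ?thesis
    using assms by (simp add: mult_left_mono)
qed

text \<open>Strong induction: at the last point of \<open>B\<close>, cut off its window, which removes at most \<open>L + 1\<close> points
  of \<open>B\<close> and lowers the potential \<open>phi\<close> by at least \<open>c\<close>.\<close>
lemma card_sparse_le:
  fixes B :: "nat set" and width :: "nat \<Rightarrow> nat" and phi :: "nat \<Rightarrow> real" and L c :: real
  assumes "c > 0" "L \<ge> 0" "mono phi" "phi 0 \<ge> 0" "0 \<notin> B"
    and sparse: "\<And>t. Suc t \<in> B \<Longrightarrow> real (card (B \<inter> {t - width t + 1..t})) \<le> L"
    and gain: "\<And>t. Suc t \<in> B \<Longrightarrow> phi (t - width t) + c \<le> phi (Suc t)"
  shows "real (card (B \<inter> {..T})) \<le> (L + 1) * phi T / c"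
proof (induction T rule: less_induct)
  case (less T)
  have phi: "phi t \<ge> 0" for t
    using \<open>mono phi\<close> \<open>phi 0 \<ge> 0\<close> monoD[of phi 0 t] by simp
  show ?case
  proof (cases T)
    case 0
    then have "B \<inter> {..T} = {}"
      using \<open>0 \<notin> B\<close> by auto
    then have "card (B \<inter> {..T}) = 0"
      by simp
    then show ?thesis
      using assms phi[of T] by simp
  next
    case (Suc t)
    show ?thesis
    proof (cases "Suc t \<in> B")
      case False
      then have "B \<inter> {..T} = B \<inter> {..t}"
        using Suc by (auto simp: le_Suc_eq)
      then have "real (card (B \<inter> {..T})) \<le> (L + 1) * phi t / c"
        using less[of t] Suc by simp
      also have "\<dots> \<le> (L + 1) * phi T / c"
        using \<open>L \<ge> 0\<close> \<open>c > 0\<close> Suc by (intro divide_right_mono mult_left_mono monoD[OF \<open>mono phi\<close>]) simp_all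
      finally show ?thesis .
    next
      case True
      let ?u = "t - width t"
      have "card (B \<inter> {..T}) \<le> card (insert (Suc t) (B \<inter> {..?u} \<union> B \<inter> {?u + 1..t}))"
        using Suc by (intro card_mono) auto
      also have "\<dots> \<le> Suc (card (B \<inter> {..?u} \<union> B \<inter> {?u + 1..t}))"
        by (rule card_insert_le_m1) auto
      also have "\<dots> \<le> Suc (card (B \<inter> {..?u}) + card (B \<inter> {?u + 1..t}))"
        by (simp add: card_Un_le)
      finally have "real (card (B \<inter> {..T})) \<le> real (card (B \<inter> {..?u})) + L + 1"
        using sparse[OF True] by linarith
      also have "real (card (B \<inter> {..?u})) \<le> (L + 1) * phi ?u / c"
        using Suc by (intro less) auto
      also have "(L + 1) * phi ?u / c + L + 1 = (L + 1) * (phi ?u + c) / c"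
        using \<open>c > 0\<close> by (simp add: field_simps)
      also have "\<dots> \<le> (L + 1) * phi T / c"
        using \<open>L \<ge> 0\<close> \<open>c > 0\<close> Suc gain[OF True] by (intro divide_right_mono mult_left_mono) simp_all
      finally show ?thesis by simp
    qed
  qed
qed

section \<open>Windows spoiled by breakpoints\<close>

lemma ex_change_between:
  fixes f :: "nat \<Rightarrow> 'a"
  assumes "f s \<noteq> f t" "s \<le> t"
  obtains b where "s < b" "b \<le> t" "f b \<noteq> f (b - 1)"
proof -
  have "f t = f s" if "\<forall>b. s < b \<and> b \<le> t \<longrightarrow> f b = f (b - 1)"
    using \<open>s \<le> t\<close> that
  proof (induction t rule: dec_induct)
    case (step n)
    then have "f (Suc n) = f n"
      by (metis diff_Suc_1 le_imp_less_Suc order_refl)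
    then show ?case
      using step by simp
  qed simp
  then show ?thesis
    using \<open>f s \<noteq> f t\<close> that by fastforce
qed

text \<open>Each bad \<open>t\<close> is charged to a breakpoint \<open>b\<close> with
  \<open>s < b \<le> Suc t\<close>. Since \<open>s\<close> lies in the window ending at
  \<open>t\<close>, such a \<open>t\<close> is one of the \<open>W\<close> numbers from
  \<open>b - 1\<close> on. The block starts at \<open>b - 1\<close> because the change may happen in
  round \<open>Suc t\<close> itself.\<close>

lemma card_broken_windows_le:
  fixes f :: "nat \<Rightarrow> 'a" and width :: "nat \<Rightarrow> nat"
  assumes "\<And>t. t < T \<Longrightarrow> width t \<le> W"
  shows "card {t \<in> {1..<T}. \<exists>s\<in>{t - width t + 1..t}. f s \<noteq> f (Suc t)}
           \<le> card {b \<in> {2..T}. f b \<noteq> f (b - 1)} * W"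
proof -
  let ?br = "{b \<in> {2..T}. f b \<noteq> f (b - 1)}"
  have subset: "{t \<in> {1..<T}. \<exists>s\<in>{t - width t + 1..t}. f s \<noteq> f (Suc t)} \<subseteq> (\<Union>b\<in>?br. {b - 1..<b - 1 + W})"
  proof
    fix t assume "t \<in> {t \<in> {1..<T}. \<exists>s\<in>{t - width t + 1..t}. f s \<noteq> f (Suc t)}"
    then obtain s where t: "1 \<le> t" "t < T" and s: "t - width t + 1 \<le> s" "s \<le> t" "f s \<noteq> f (Suc t)"
      by auto
    obtain b where b: "s < b" "b \<le> Suc t" "f b \<noteq> f (b - 1)"
      using ex_change_between[of f s "Suc t"] s by (metis le_SucI)
    have "b \<in> ?br"
      using b s t by simp
    moreover have "t \<in> {b - 1..<b - 1 + W}"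
      using assms[OF \<open>t < T\<close>] b(1,2) s(1) t(1) unfolding atLeastLessThan_iff by linarith
    ultimately show "t \<in> (\<Union>b\<in>?br. {b - 1..<b - 1 + W})"
      by blast
  qed
  have "card {t \<in> {1..<T}. \<exists>s\<in>{t - width t + 1..t}. f s \<noteq> f (Suc t)}
      \<le> card (\<Union>b\<in>?br. {b - 1..<b - 1 + W})"
    by (rule card_mono[OF _ subset]) simp
  also have "\<dots> \<le> (\<Sum>b\<in>?br. card {b - 1..<b - 1 + W})"
    by (rule card_UN_le) simp
  also have "\<dots> = card ?br * W"
    by simp
  finally show ?thesis .
qed

subsection \<open>Concentration of the windowed sample means\<close>

text \<open>Measurability of the arms is assumed because \<open>sel\<close> is an arbitrary function
  of real-valued rewards. The bound \<open>alpha \<le> 1 / 2\<close> reflects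
  \<open>nu \<ge> 0\<close>.\<close>

locale sw_ucb =
  fixes N :: nat and lam alpha :: real
    and sel :: "nat \<Rightarrow> (nat \<times> real) list \<Rightarrow> nat set \<Rightarrow> nat"
    and D :: "nat \<Rightarrow> nat \<Rightarrow> real measure"
  assumes N_pos: "N \<ge> 1" and lam_pos: "lam > 0" and alpha_pos: "0 < alpha" and alpha_le: "alpha \<le> 1 / 2"
    and D_prob: "\<And>j t. j < N \<Longrightarrow> prob_space (D j t)"
    and D_sets: "\<And>j t. j < N \<Longrightarrow> sets (D j t) = sets borel"
    and D_bounded: "\<And>j t. j < N \<Longrightarrow> AE x in D j t. 0 \<le> x \<and> x \<le> 1"
    and sel_in: "\<And>t h S. S \<noteq> {} \<Longrightarrow> sel t h S \<in> S"
    and arm_measurable: "\<And>t. t \<ge> 1 \<Longrightarrow>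
      (\<lambda>w. sw_arm N lam alpha sel w t) \<in> reward_space N D \<rightarrow>\<^sub>M count_space UNIV"
begin

section \<open>The algorithm in terms of windows, pulls and indices\<close>

abbreviation arm :: "(nat \<times> nat \<Rightarrow> real) \<Rightarrow> nat \<Rightarrow> nat" where
  "arm \<equiv> sw_arm N lam alpha sel"

text \<open>The window ends at \<open>t\<close> and is the one that decides the arm of round
  \<open>Suc t\<close>.\<close>

abbreviation window :: "nat \<Rightarrow> nat set" where
  "window t \<equiv> {t - sw_width lam alpha t + 1..t}"

definition pulls :: "nat \<Rightarrow> nat \<Rightarrow> (nat \<times> nat \<Rightarrow> real) \<Rightarrow> nat set" where
  "pulls j t w = {s \<in> window t. arm w s = j}"

text \<open>Each reward is centred at the mean of its own round, so this is a martingale sum even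
  when the means change within the window.\<close>

definition deviation :: "nat \<Rightarrow> nat \<Rightarrow> (nat \<times> nat \<Rightarrow> real) \<Rightarrow> real" where
  "deviation j t w = (\<Sum>s\<in>pulls j t w. w (j, s) - arm_mean D j s)"

definition index :: "(nat \<times> nat \<Rightarrow> real) \<Rightarrow> nat \<Rightarrow> nat \<Rightarrow> ereal" where
  "index w t j = (if pulls j t w = {} then \<infinity>
     else ereal ((\<Sum>s\<in>pulls j t w. w (j, s)) / real (card (pulls j t w))
                 + sqrt ((1 + alpha) * ln (real t) / real (card (pulls j t w)))))"

lemma finite_pulls [simp]: "finite (pulls j t w)"
  by (simp add: pulls_def)

lemma length_sw_hist [simp]: "length (sw_hist N lam alpha sel w t) = t"
  by (induction t) (auto simp: Let_def)

lemma sw_hist_nth: "s < t \<Longrightarrow> sw_hist N lam alpha sel w t ! s = arm w (Suc s)"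
proof (induction t)
  case (Suc t)
  then show ?case
    by (cases "s = t") (auto simp: Let_def nth_append sw_arm_def simp del: One_nat_def)
qed simp

text \<open>Every \<open>s\<close> in the window satisfies \<open>1 \<le> s \<le> t\<close>, so
  entry \<open>s - 1\<close> of the history is the arm of round \<open>s\<close>. On the pulls of
  \<open>j\<close> the observed reward is the potential reward \<open>w (j, s)\<close>.\<close>

lemma swucb_index_eq:
  "swucb_index lam alpha (\<lambda>s. sw_hist N lam alpha sel w t ! (s - 1))
     (\<lambda>s. w (sw_hist N lam alpha sel w t ! (s - 1), s)) t j = index w t j"
proof -
  have hist: "sw_hist N lam alpha sel w t ! (s - 1) = arm w s" if "s \<in> window t" for s
    using that sw_hist_nth[of "s - 1" t w] by auto
  then have S: "{s \<in> window t. sw_hist N lam alpha sel w t ! (s - 1) = j} = pulls j t w"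
    by (auto simp: pulls_def)
  have "(\<Sum>s\<in>pulls j t w. w (sw_hist N lam alpha sel w t ! (s - 1), s)) = (\<Sum>s\<in>pulls j t w. w (j, s))"
    using hist by (intro sum.cong) (auto simp: pulls_def)
  then show ?thesis
    unfolding swucb_index_def index_def Let_def S by simp
qed

lemma arm_Suc:
  "arm w (Suc t) = (if Suc t \<le> N then t
     else sel (Suc t) (map (\<lambda>s. (arm w s, w (arm w s, s))) [1..<Suc t])
            {j. j < N \<and> (\<forall>k<N. index w t k \<le> index w t j)})"
proof -
  have hist: "map (\<lambda>s. (sw_hist N lam alpha sel w t ! (s - 1), w (sw_hist N lam alpha sel w t ! (s - 1), s))) [1..<Suc t]
      = map (\<lambda>s. (arm w s, w (arm w s, s))) [1..<Suc t]"
    using sw_hist_nth[of "s - 1" t w for s] by (intro map_cong) auto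
  then show ?thesis
    unfolding sw_arm_def[of _ _ _ _ _ "Suc t"]
    by (simp add: Let_def swucb_index_eq nth_append hist del: upt_Suc One_nat_def map_eq_conv)
qed

lemma arm_Suc_in_maximisers:
  assumes "N \<le> t"
  shows "arm w (Suc t) \<in> {j. j < N \<and> (\<forall>k<N. index w t k \<le> index w t j)}"
proof -
  have "Max (index w t ` {..<N}) \<in> index w t ` {..<N}"
    using N_pos by (intro Max_in) (auto simp: lessThan_empty_iff)
  then obtain j where "j < N" "index w t j = Max (index w t ` {..<N})"
    by auto
  then have "j \<in> {j. j < N \<and> (\<forall>k<N. index w t k \<le> index w t j)}"
    by auto
  then have "{j. j < N \<and> (\<forall>k<N. index w t k \<le> index w t j)} \<noteq> {}"
    by blast
  moreover have "\<not> Suc t \<le> N"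
    using assms by simp
  ultimately show ?thesis
    unfolding arm_Suc by (simp only: if_False) (rule sel_in)
qed

lemma arm_less:
  assumes "t \<ge> 1"
  shows "arm w t < N"
proof -
  obtain u where u: "t = Suc u"
    using assms by (cases t) auto
  show ?thesis
  proof (cases "Suc u \<le> N")
    case True
    then show ?thesis
      unfolding u arm_Suc by simp
  next
    case False
    then show ?thesis
      unfolding u using arm_Suc_in_maximisers[of u w] by simp
  qed
qed

text \<open>Predictability: the index at \<open>t - 1\<close> and the history given to
  \<open>sel\<close> involve only rewards of earlier rounds. This makes the current reward
  independent of the decision to collect it.\<close>

lemma arm_cong:
  assumes "\<And>j s. j < N \<Longrightarrow> 1 \<le> s \<Longrightarrow> s < t \<Longrightarrow> w (j, s) = w' (j, s)" "t \<ge> 1"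
  shows "arm w t = arm w' t"
  using assms
proof (induction t rule: less_induct)
  case (less t)
  obtain u where u: "t = Suc u"
    using less.prems by (cases t) auto
  have IH: "arm w s = arm w' s" if "1 \<le> s" "s \<le> u" for s
    using that u less.prems by (intro less.IH) auto
  have pulls: "pulls j u w = pulls j u w'" for j
    using IH by (auto simp: pulls_def)
  have "(\<Sum>s\<in>pulls j u w'. w (j, s)) = (\<Sum>s\<in>pulls j u w'. w' (j, s))" if "j < N" for j
    using that u less.prems by (intro sum.cong) (auto simp: pulls_def)
  then have "index w u j = index w' u j" if "j < N" for j
    using that by (simp add: index_def pulls)
  then have maximisers: "{j. j < N \<and> (\<forall>k<N. index w u k \<le> index w u j)}
      = {j. j < N \<and> (\<forall>k<N. index w' u k \<le> index w' u j)}"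
    by auto
  have hist: "map (\<lambda>s. (arm w s, w (arm w s, s))) [1..<Suc u] = map (\<lambda>s. (arm w' s, w' (arm w' s, s))) [1..<Suc u]"
    using IH u less.prems arm_less by (intro map_cong) auto
  then show ?case
    by (simp only: u arm_Suc maximisers hist)
qed

section \<open>The reward space and its exponential supermartingale\<close>

lemma prob_space_reward_space: "prob_space (reward_space N D)"
  unfolding reward_space_def by (intro prob_space_PiM) (auto simp: D_prob)

lemma reward_measurable [measurable]:
  "j < N \<Longrightarrow> (\<lambda>w. w (j, t)) \<in> borel_measurable (reward_space N D)"
proof -
  assume j: "j < N"
  have "(\<lambda>w. w (j, t)) \<in> reward_space N D \<rightarrow>\<^sub>M (\<lambda>(j, t). D j t) (j, t)"
    unfolding reward_space_def using j by (intro measurable_component_singleton) auto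
  then show ?thesis
    using measurable_cong_sets[OF refl D_sets[OF j, of t], of "reward_space N D"] by simp
qed

lemma pred_arm [measurable]: "t \<ge> 1 \<Longrightarrow> Measurable.pred (reward_space N D) (\<lambda>w. arm w t = j)"
  using arm_measurable[of t] by measurable

text \<open>Logarithm of one factor of the supermartingale; rounds that play another arm contribute
  the factor 1.\<close>

definition log_tilt :: "real \<Rightarrow> nat \<Rightarrow> nat \<Rightarrow> (nat \<times> nat \<Rightarrow> real) \<Rightarrow> real" where
  "log_tilt h j s w = (if arm w s = j then h * (w (j, s) - arm_mean D j s) - h\<^sup>2 / 8 else 0)"

lemma log_tilt_measurable [measurable]:
  "j < N \<Longrightarrow> s \<ge> 1 \<Longrightarrow> log_tilt h j s \<in> borel_measurable (reward_space N D)"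
  unfolding log_tilt_def by measurable

lemma exp_centered_reward:
  assumes "j < N"
  shows "integrable (D j t) (\<lambda>x. exp (h * (x - arm_mean D j t) - h\<^sup>2 / 8))"
    and "(\<integral>x. exp (h * (x - arm_mean D j t) - h\<^sup>2 / 8) \<partial>D j t) \<le> 1"
proof -
  interpret D: prob_space "D j t" by (rule D_prob[OF assms])
  note [measurable_cong] = D_sets[OF assms, of t]
  have meas: "(\<lambda>x. x) \<in> borel_measurable (D j t)"
    by (rule measurable_ident_sets[OF D_sets[OF assms]])
  have b: "AE x in D j t. x \<in> {0..1}"
    using D_bounded[OF assms] by simp
  show "(\<integral>x. exp (h * (x - arm_mean D j t) - h\<^sup>2 / 8) \<partial>D j t) \<le> 1"
    using D.integral_exp_centered_le_1[OF meas b, of h] by (simp add: arm_mean_def)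
  show "integrable (D j t) (\<lambda>x. exp (h * (x - arm_mean D j t) - h\<^sup>2 / 8))"
  proof (rule D.integrable_const_bound)
    show "AE x in D j t. norm (exp (h * (x - arm_mean D j t) - h\<^sup>2 / 8))
        \<le> exp (\<bar>h\<bar> + \<bar>h * arm_mean D j t\<bar>)"
      using b
    proof eventually_elim
      case (elim x)
      have "\<bar>h * x\<bar> \<le> \<bar>h\<bar> * 1"
        unfolding abs_mult using elim by (intro mult_left_mono) auto
      then have "h * (x - arm_mean D j t) - h\<^sup>2 / 8 \<le> \<bar>h\<bar> + \<bar>h * arm_mean D j t\<bar>"
        unfolding right_diff_distrib using zero_le_power2[of h] by linarith
      then show ?case
        by simp
    qed
  qed (intro measurable_compose[OF meas], measurable)
qed

text \<open>The supermartingale behind the tail bound: \<open>arm w s\<close> depends only on rewards before time \<open>s\<close>,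
  so conditionally on the past each factor has expectation at most 1 by Hoeffding's lemma.\<close>
lemma expectation_exp_log_tilt:
  assumes j: "j < N" and a: "1 \<le> a"
  shows "integrable (reward_space N D) (\<lambda>w. exp (\<Sum>s\<in>{a..<k}. log_tilt h j s w)) \<and>
    integral\<^sup>L (reward_space N D) (\<lambda>w. exp (\<Sum>s\<in>{a..<k}. log_tilt h j s w)) \<le> 1"
proof -
  interpret P: prob_space "reward_space N D"
    by (rule prob_space_reward_space)
  show ?thesis
  proof (induction k)
    case 0
    then show ?case by (simp add: P.prob_space)
  next
    case (Suc k)
    let ?M = "\<lambda>(j, t). D j t"
    let ?F = "\<lambda>w. exp (\<Sum>s\<in>{a..<k}. log_tilt h j s w)"
    let ?e = "\<lambda>x. exp (h * (x - arm_mean D j k) - h\<^sup>2 / 8)"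
    show ?case
    proof (cases "a \<le> k")
      case False
      then show ?thesis by (simp add: P.prob_space)
    next
      case True
      have [measurable]: "Measurable.pred (reward_space N D) (\<lambda>w. arm w k = j)"
        using True a by (intro pred_arm) auto
      \<comment> \<open>Splitting by the arm of round \<open>k\<close> takes the place of
        conditioning on the past: the new factor is 1 on the part \<open>F1\<close>, and on
        \<open>F2\<close> it is a function of the single fresh reward
        \<open>w (j, k)\<close>.\<close>
      define F1 F2 where "F1 w = (if arm w k = j then 0 else ?F w)"
        and "F2 w = (if arm w k = j then ?F w else 0)" for w
      have [measurable]: "?F \<in> borel_measurable (reward_space N D)"
        using j a by (intro measurable_compose[OF _ borel_measurable_exp] borel_measurable_sum
            log_tilt_measurable) auto
      have int_F: "integrable (reward_space N D) ?F"
        using Suc by blast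
      have int: "integrable (reward_space N D) F1" "integrable (reward_space N D) F2"
        by (rule Bochner_Integration.integrable_bound[OF int_F]; auto simp: F1_def[abs_def] F2_def[abs_def])+
      \<comment> \<open>The arm of round \<open>k\<close> and all earlier factors are determined by
        rewards before \<open>k\<close>, so \<open>F2\<close> is independent of coordinate
        \<open>(j, k)\<close>.\<close>
      have local: "F2 w = F2 w'" if "\<And>q. q \<in> {..<N} \<times> {1..<k} \<Longrightarrow> w q = w' q" for w w'
      proof -
        have arms: "arm w s = arm w' s" if "1 \<le> s" "s \<le> k" for s
          using that \<open>\<And>q. q \<in> {..<N} \<times> {1..<k} \<Longrightarrow> w q = w' q\<close> by (intro arm_cong) auto
        have "(\<Sum>s\<in>{a..<k}. log_tilt h j s w) = (\<Sum>s\<in>{a..<k}. log_tilt h j s w')"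
          using that arms j a by (intro sum.cong) (auto simp: log_tilt_def)
        then show ?thesis
          using arms[of k] True a by (simp add: F2_def)
      qed
      have J: "{..<N} \<times> {1..<k} \<subseteq> {..<N} \<times> (UNIV :: nat set)"
        by auto
      have int_e: "integrable (?M (j, k)) ?e" "(\<integral>x. ?e x \<partial>?M (j, k)) \<le> 1"
        using exp_centered_reward[OF j] by auto
      have prod: "integral\<^sup>L (reward_space N D) (\<lambda>w. F2 w * ?e (w (j, k))) = integral\<^sup>L (reward_space N D) F2 * (\<integral>x. ?e x \<partial>?M (j, k))"
        "integrable (reward_space N D) (\<lambda>w. F2 w * ?e (w (j, k)))"
        unfolding reward_space_def
        by (rule integral_PiM_mult_component[OF _ J _ int(2)[unfolded reward_space_def] int_e(1) local];
            use j in \<open>auto simp: D_prob\<close>)+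
      have split: "(\<lambda>w. exp (\<Sum>s\<in>{a..<Suc k}. log_tilt h j s w)) = (\<lambda>w. F1 w + F2 w * ?e (w (j, k)))"
        using True by (auto simp: F1_def F2_def log_tilt_def exp_add)
      have F2_nonneg: "integral\<^sup>L (reward_space N D) F2 \<ge> 0"
        by (intro Bochner_Integration.integral_nonneg) (simp add: F2_def)
      have "integral\<^sup>L (reward_space N D) (\<lambda>w. F1 w + F2 w * ?e (w (j, k)))
          = integral\<^sup>L (reward_space N D) F1 + integral\<^sup>L (reward_space N D) F2 * (\<integral>x. ?e x \<partial>?M (j, k))"
        using int prod by (subst Bochner_Integration.integral_add) auto
      also have "\<dots> \<le> integral\<^sup>L (reward_space N D) F1 + integral\<^sup>L (reward_space N D) F2"
        using mult_left_mono[OF int_e(2) F2_nonneg] by simp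
      also have "\<dots> = integral\<^sup>L (reward_space N D) (\<lambda>w. F1 w + F2 w)"
        using int by simp
      also have "(\<lambda>w. F1 w + F2 w) = ?F"
        by (auto simp: F1_def F2_def)
      also have "integral\<^sup>L (reward_space N D) ?F \<le> 1"
        using Suc by blast
      finally show ?thesis
        unfolding split using int(1) prod(2) by simp
    qed
  qed
qed

section \<open>Tail bounds for the deviations\<close>

lemma deviation_eq: "deviation j t w = (\<Sum>s\<in>window t. if arm w s = j then w (j, s) - arm_mean D j s else 0)"
  unfolding deviation_def pulls_def by (rule sum.inter_filter) simp

lemma card_pulls_eq: "card (pulls j t w) = (\<Sum>s\<in>window t. if arm w s = j then 1 else 0)"
  unfolding card_eq_sum pulls_def by (rule sum.inter_filter) simp

lemma deviation_measurable [measurable]: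
  "j < N \<Longrightarrow> deviation j t \<in> borel_measurable (reward_space N D)"
  unfolding deviation_eq[abs_def] by measurable (auto intro!: arm_measurable)

lemma card_pulls_measurable [measurable]:
  "(\<lambda>w. card (pulls j t w)) \<in> reward_space N D \<rightarrow>\<^sub>M count_space UNIV"
  unfolding card_pulls_eq by measurable (auto intro!: arm_measurable)

lemma card_pulls_le: "card (pulls j t w) \<le> t"
proof -
  have "card (pulls j t w) \<le> card {1..t}"
    by (intro card_mono) (auto simp: pulls_def)
  then show ?thesis by simp
qed

text \<open>Chernoff bound on the event that the random sample count equals \<open>n\<close>, which
  allows the tilt to be tuned to \<open>n\<close>. The sign \<open>eps\<close> covers both
  tails.\<close>

lemma prob_deviation_ge:
  assumes j: "j < N" and "n \<ge> 1" "x \<ge> 0" and eps: "eps = 1 \<or> eps = (-1 :: real)"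
  shows "measure (reward_space N D) {w \<in> space (reward_space N D).
      card (pulls j t w) = n \<and> sqrt (x * real n) \<le> eps * deviation j t w} \<le> exp (- 2 * x)"
proof -
  interpret P: prob_space "reward_space N D"
    by (rule prob_space_reward_space)
  \<comment> \<open>This \<open>h\<close> maximises \<open>h * y - h\<^sup>2 / 8 * n\<close> at
    \<open>y = eps * sqrt (x * n)\<close>. The maximum is \<open>4 * x - 2 * x = 2 * x\<close>, the
    exponent of the bound.\<close>
  define h where "h = eps * (4 * sqrt (x / real n))"
  let ?a = "t - sw_width lam alpha t + 1"
  let ?S = "\<lambda>w. \<Sum>s\<in>{?a..<Suc t}. log_tilt h j s w"
  have S: "?S w = h * deviation j t w - h\<^sup>2 / 8 * real (card (pulls j t w))" for w
  proof -
    have "?S w = (\<Sum>s\<in>pulls j t w. h * (w (j, s) - arm_mean D j s) - h\<^sup>2 / 8)"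
      unfolding log_tilt_def pulls_def atLeastLessThanSuc_atLeastAtMost
      by (rule sum.inter_filter[symmetric]) simp
    also have "\<dots> = (\<Sum>s\<in>pulls j t w. h * (w (j, s) - arm_mean D j s)) - h\<^sup>2 / 8 * real (card (pulls j t w))"
      by (simp add: sum_subtractf)
    finally show ?thesis
      by (simp add: deviation_def sum_distrib_left)
  qed
  have mgf: "integrable (reward_space N D) (\<lambda>w. exp (?S w))" "integral\<^sup>L (reward_space N D) (\<lambda>w. exp (?S w)) \<le> 1"
    using expectation_exp_log_tilt[OF j, of ?a h "Suc t"] by auto
  have "measure (reward_space N D) {w \<in> space (reward_space N D).
      card (pulls j t w) = n \<and> sqrt (x * real n) \<le> eps * deviation j t w}
    \<le> measure (reward_space N D) {w \<in> space (reward_space N D). exp (2 * x) \<le> exp (?S w)}"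
  proof (rule P.finite_measure_mono)
    show "{w \<in> space (reward_space N D). card (pulls j t w) = n \<and> sqrt (x * real n) \<le> eps * deviation j t w}
        \<subseteq> {w \<in> space (reward_space N D). exp (2 * x) \<le> exp (?S w)}"
    proof
      fix w assume "w \<in> {w \<in> space (reward_space N D).
        card (pulls j t w) = n \<and> sqrt (x * real n) \<le> eps * deviation j t w}"
      then have w: "w \<in> space (reward_space N D)" and n: "card (pulls j t w) = n"
        and dev: "sqrt (x * real n) \<le> eps * deviation j t w"
        by auto
      have "4 * x = 4 * sqrt (x / real n) * sqrt (x * real n)"
        using assms by (simp flip: real_sqrt_mult)
      also have "\<dots> \<le> 4 * sqrt (x / real n) * (eps * deviation j t w)"
        using dev assms by (intro mult_left_mono) auto
      also have "\<dots> = h * deviation j t w"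
        by (simp add: h_def)
      finally have "4 * x \<le> h * deviation j t w" .
      moreover have "h\<^sup>2 / 8 * real n = 2 * x"
        using assms by (auto simp: h_def power_mult_distrib)
      ultimately show "w \<in> {w \<in> space (reward_space N D). exp (2 * x) \<le> exp (?S w)}"
        unfolding S using n w by simp
    qed
    have "(\<lambda>w. exp (?S w)) \<in> borel_measurable (reward_space N D)"
      using mgf by auto
    then show "{w \<in> space (reward_space N D). exp (2 * x) \<le> exp (?S w)} \<in> sets (reward_space N D)"
      by measurable
  qed
  also have "\<dots> \<le> integral\<^sup>L (reward_space N D) (\<lambda>w. exp (?S w)) / exp (2 * x)"
    using mgf by (intro integral_Markov_inequality_measure[where A = "{}"]) auto
  also have "\<dots> \<le> 1 / exp (2 * x)"
    using mgf by (intro divide_right_mono) auto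
  finally show ?thesis
    by (simp add: exp_minus field_simps)
qed

text \<open>The confidence condition multiplied through by the sample count. While the means stay
  constant over the window and up to the decision, \<open>deviation\<close> divided by the count is
  the error of the sample mean.\<close>

definition misestimated :: "nat \<Rightarrow> (nat \<times> nat \<Rightarrow> real) \<Rightarrow> bool" where
  "misestimated t w \<longleftrightarrow> (\<exists>j<N. pulls j t w \<noteq> {} \<and>
     sqrt ((1 + alpha) * ln (real t) * real (card (pulls j t w))) \<le> \<bar>deviation j t w\<bar>)"

lemma misestimated_events [measurable]:
  "{w \<in> space (reward_space N D). misestimated t w} \<in> sets (reward_space N D)"
proof -
  have "misestimated t w \<longleftrightarrow> (\<exists>j\<in>{..<N}. card (pulls j t w) \<noteq> 0 \<and>
      sqrt ((1 + alpha) * ln (real t) * real (card (pulls j t w))) \<le> \<bar>deviation j t w\<bar>)" for w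
    by (auto simp: misestimated_def)
  then show ?thesis
    by (simp only:) measurable
qed

text \<open>The sample count is random, hence a union bound over its values \<open>1..t\<close>, the
  \<open>N\<close> arms and the two signs. Each of the \<open>2 * N * t\<close> events has
  probability at most \<open>exp (- 2 * ln t)\<close>, the inverse square of
  \<open>t\<close>.\<close>

lemma prob_misestimated_le:
  assumes "t \<ge> 1"
  shows "measure (reward_space N D) {w \<in> space (reward_space N D). misestimated t w} \<le> 2 * real N / real t"
proof -
  interpret P: prob_space "reward_space N D"
    by (rule prob_space_reward_space)
  define x where "x = (1 + alpha) * ln (real t)"
  have x: "ln (real t) \<le> x" "0 \<le> x"
    using assms alpha_pos by (auto simp: x_def field_simps)
  define E where "E = (\<lambda>(j, n, eps). {w \<in> space (reward_space N D).
      card (pulls j t w) = n \<and> sqrt (x * real n) \<le> eps * deviation j t w})"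
  let ?I = "{..<N} \<times> {1..t} \<times> {1, -1 :: real}"
  have E_events: "E i \<in> sets (reward_space N D)" if "i \<in> ?I" for i
    using that unfolding E_def by (auto; measurable)
  have E_prob: "measure (reward_space N D) (E i) \<le> exp (- 2 * x)" if "i \<in> ?I" for i
  proof -
    obtain j n e where i: "i = (j, n, e)"
      by (cases i)
    then have "j < N" "1 \<le> n" "e = 1 \<or> e = - 1"
      using that by auto
    then show ?thesis
      unfolding i E_def prod.case using x(2) by (intro prob_deviation_ge)
  qed
  have "{w \<in> space (reward_space N D). misestimated t w} \<subseteq> (\<Union>i\<in>?I. E i)"
  proof
    fix w assume "w \<in> {w \<in> space (reward_space N D). misestimated t w}"
    then obtain j where w: "w \<in> space (reward_space N D)" and j: "j < N" "pulls j t w \<noteq> {}"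
      and "sqrt (x * real (card (pulls j t w))) \<le> \<bar>deviation j t w\<bar>"
      by (auto simp: misestimated_def x_def)
    then have "w \<in> E (j, card (pulls j t w), 1) \<or> w \<in> E (j, card (pulls j t w), -1)"
      by (auto simp: E_def abs_if split: if_splits)
    moreover have "(j, card (pulls j t w), s) \<in> ?I" if "s \<in> {1, -1}" for s
      using j card_pulls_le[of j t w] that by (auto simp: Suc_le_eq card_gt_0_iff)
    ultimately show "w \<in> (\<Union>i\<in>?I. E i)"
      by blast
  qed
  then have "measure (reward_space N D) {w \<in> space (reward_space N D). misestimated t w} \<le> measure (reward_space N D) (\<Union>i\<in>?I. E i)"
    using E_events by (intro P.finite_measure_mono sets.finite_UN) auto
  also have "\<dots> \<le> (\<Sum>i\<in>?I. measure (reward_space N D) (E i))"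
    using E_events by (intro P.finite_measure_subadditive_finite) auto
  also have "\<dots> \<le> (\<Sum>i\<in>?I. exp (- 2 * x))"
    by (intro sum_mono E_prob)
  also have "\<dots> = 2 * real N * real t * exp (- 2 * x)"
    by simp
  also have "exp (- 2 * x) \<le> exp (- 2 * ln (real t))"
    using x by simp
  also have "exp (- 2 * ln (real t)) = 1 / (real t)\<^sup>2"
    using assms by (simp add: exp_minus exp_double divide_inverse)
  also have "2 * real N * real t * (1 / (real t)\<^sup>2) = 2 * real N / real t"
    using assms by (simp add: power2_eq_square)
  finally show ?thesis
    by (simp add: mult_left_mono)
qed

subsection \<open>Regret\<close>

lemma arm_mean_bounds:
  assumes "j < N"
  shows "0 \<le> arm_mean D j t" "arm_mean D j t \<le> 1"
proof -
  interpret D: prob_space "D j t" by (rule D_prob[OF assms])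
  have meas: "(\<lambda>x. x) \<in> borel_measurable (D j t)"
    by (rule measurable_ident_sets[OF D_sets[OF assms]])
  have b: "AE x in D j t. 0 \<le> x \<and> x \<le> 1"
    by (rule D_bounded[OF assms])
  have int: "integrable (D j t) (\<lambda>x. x)"
    using b by (intro D.integrable_const_bound[where B = 1] meas) auto
  show "0 \<le> arm_mean D j t"
    unfolding arm_mean_def using b by (intro integral_nonneg_AE) auto
  show "arm_mean D j t \<le> 1"
    unfolding arm_mean_def using b by (intro D.integral_le_const int) auto
qed

definition regret_at :: "(nat \<times> nat \<Rightarrow> real) \<Rightarrow> nat \<Rightarrow> real" where
  "regret_at w t = Max {arm_mean D k t | k. k < N} - arm_mean D (arm w t) t"

lemma Max_mean_eq:
  assumes "i < N" "\<And>j. j < N \<Longrightarrow> arm_mean D j t \<le> arm_mean D i t"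
  shows "Max {arm_mean D k t | k. k < N} = arm_mean D i t"
  using assms by (intro Max_eqI) auto

lemma regret_at_bounds:
  assumes "t \<ge> 1"
  shows "0 \<le> regret_at w t" "regret_at w t \<le> 1"
proof -
  have fin: "finite {arm_mean D k t | k. k < N}"
    by simp
  have "arm_mean D (arm w t) t \<in> {arm_mean D k t | k. k < N}"
    using arm_less[OF assms] by blast
  then show "0 \<le> regret_at w t"
    unfolding regret_at_def using Max_ge[OF fin] by simp
  have "Max {arm_mean D k t | k. k < N} \<in> {arm_mean D k t | k. k < N}"
    using N_pos by (intro Max_in fin) (auto intro!: exI[of _ 0])
  then obtain k where "k < N" "Max {arm_mean D k t | k. k < N} = arm_mean D k t"
    by blast
  then show "regret_at w t \<le> 1"
    unfolding regret_at_def using arm_mean_bounds(2)[of k t] arm_mean_bounds(1)[of "arm w t" t] arm_less[OF assms, of w]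
    by simp
qed

lemma regret_at_integrable:
  assumes t: "t \<ge> 1"
  shows "integrable (reward_space N D) (\<lambda>w. regret_at w t)"
proof -
  interpret P: prob_space "reward_space N D"
    by (rule prob_space_reward_space)
  have "(\<lambda>w. Max {arm_mean D k t | k. k < N} - arm_mean D (arm w t) t) \<in> borel_measurable (reward_space N D)"
    by (rule measurable_compose[OF arm_measurable[OF t]]) simp
  then have "(\<lambda>w. regret_at w t) \<in> borel_measurable (reward_space N D)"
    by (simp add: regret_at_def)
  then show ?thesis
    using regret_at_bounds[OF t] by (intro P.integrable_const_bound[where B = 1]) auto
qed

text \<open>Restriction to the actual arms turns agreement of all means into equality of functions,
  as needed for \<open>card_broken_windows_le\<close>.\<close>

definition mean_vector :: "nat \<Rightarrow> nat \<Rightarrow> real" where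
  "mean_vector t = (\<lambda>j\<in>{..<N}. arm_mean D j t)"

lemma mean_vector_eq_iff: "mean_vector s = mean_vector t \<longleftrightarrow> (\<forall>j<N. arm_mean D j s = arm_mean D j t)"
  by (auto simp: mean_vector_def restrict_def fun_eq_iff)

lemma num_breakpoints_eq:
  "num_breakpoints N (arm_mean D) T = card {b \<in> {2..T}. mean_vector b \<noteq> mean_vector (b - 1)}"
  unfolding num_breakpoints_def mean_vector_eq_iff by (rule arg_cong[where f = card]) auto

text \<open>Indexed by the end \<open>t\<close> of the window; the affected round is
  \<open>Suc t \<le> T\<close>.\<close>

definition broken :: "nat \<Rightarrow> nat set" where
  "broken T = {t \<in> {1..<T}. \<exists>s\<in>window t. mean_vector s \<noteq> mean_vector (Suc t)}"

lemma card_broken_le: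
  "real (card (broken T)) \<le> real (num_breakpoints N (arm_mean D) T) * (lam * real T powr alpha + 1)"
proof -
  define W where "W = nat \<lfloor>lam * real T powr alpha + 1\<rfloor>"
  have "sw_width lam alpha t \<le> W" if "t < T" for t
    unfolding W_def using sw_width_le_powr[of lam alpha t T] lam_pos alpha_pos that
    by (intro le_nat_floor) auto
  then have "card (broken T) \<le> num_breakpoints N (arm_mean D) T * W"
    unfolding broken_def num_breakpoints_eq by (rule card_broken_windows_le)
  then have "real (card (broken T)) \<le> real (num_breakpoints N (arm_mean D) T) * real W"
    by (metis of_nat_le_iff of_nat_mult)
  also have "real W \<le> lam * real T powr alpha + 1"
    unfolding W_def using lam_pos by (intro of_nat_floor) auto
  finally show ?thesis
    by (simp add: mult_left_mono)
qed

text \<open>Contains the played round \<open>Suc t\<close>, while the sample count belongs to the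
  window ending at \<open>t\<close>. The threshold \<open>L\<close> does not vary with
  \<open>t\<close>, so that \<open>card_sparse_le\<close> applies.\<close>

definition sparse_pulls :: "real \<Rightarrow> nat \<Rightarrow> (nat \<times> nat \<Rightarrow> real) \<Rightarrow> nat set" where
  "sparse_pulls L j w = {Suc t | t. N \<le> t \<and> arm w (Suc t) = j \<and> real (card (pulls j t w)) \<le> L}"

text \<open>Members of the set inside a window are pulls of \<open>j\<close> there, so a window
  before a member contains at most \<open>L\<close> of them. The potential is
  \<open>t powr (1 - alpha)\<close>.\<close>

lemma card_sparse_pulls_le:
  assumes "L \<ge> 0"
  shows "real (card (sparse_pulls L j w \<inter> {..T})) \<le> (L + 1) * real T powr (1 - alpha) / (min lam 1 / 4)"
proof (rule card_sparse_le[where width = "sw_width lam alpha"])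
  show "mono (\<lambda>t. real t powr (1 - alpha))"
    using alpha_le by (intro monoI powr_mono2) auto
  fix t assume "Suc t \<in> sparse_pulls L j w"
  then have t: "N \<le> t" "real (card (pulls j t w)) \<le> L"
    by (auto simp: sparse_pulls_def)
  have "card (sparse_pulls L j w \<inter> window t) \<le> card (pulls j t w)"
    by (intro card_mono) (auto simp: sparse_pulls_def pulls_def)
  then show "real (card (sparse_pulls L j w \<inter> window t)) \<le> L"
    using t by linarith
  show "real (t - sw_width lam alpha t) powr (1 - alpha) + min lam 1 / 4 \<le> real (Suc t) powr (1 - alpha)"
    using t N_pos lam_pos alpha_pos alpha_le by (intro powr_window_gain) auto
qed (use assms lam_pos in \<open>auto simp: sparse_pulls_def\<close>)

text \<open>The classical UCB argument. If all estimates are accurate, the mean of \<open>i\<close>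
  is below the index of \<open>i\<close>, which is at most the index of the played arm
  \<open>j\<close>, which is below the mean of \<open>j\<close> plus twice its radius. So the gap
  \<open>Delta\<close> is less than twice the radius, and this bounds the sample count of
  \<open>j\<close>.\<close>

lemma suboptimal_pull_cases:
  assumes "N \<le> t" "Delta > 0" "i < N"
    and gap: "arm_mean D (arm w (Suc t)) (Suc t) + Delta \<le> arm_mean D i (Suc t)"
    and const: "\<And>j s. j < N \<Longrightarrow> s \<in> window t \<Longrightarrow> arm_mean D j s = arm_mean D j (Suc t)"
  obtains (misestimated) "misestimated t w"
    | (few_pulls) "real (card (pulls (arm w (Suc t)) t w)) \<le> 4 * (1 + alpha) * ln (real t) / Delta\<^sup>2"
proof (cases "misestimated t w")
  case accurate: False
  define j where "j = arm w (Suc t)"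
  define A where "A = (1 + alpha) * ln (real t)"
  have A: "A \<ge> 0"
    using N_pos \<open>N \<le> t\<close> alpha_pos by (auto simp: A_def)
  have j: "j < N" and index: "index w t i \<le> index w t j"
    using arm_Suc_in_maximisers[OF \<open>N \<le> t\<close>, of w] \<open>i < N\<close> by (auto simp: j_def)
  have "real (card (pulls j t w)) \<le> 4 * A / Delta\<^sup>2"
  proof (cases "pulls j t w = {}")
    case True
    then show ?thesis using A by simp
  next
    case False
    \<comment> \<open>An unsampled arm has index \<open>\<infinity>\<close>, which cannot lie below
      the finite index of \<open>j\<close>.\<close>
    then have i_nonempty: "pulls i t w \<noteq> {}"
      using index by (auto simp: index_def)
    define r where "r k = sqrt (A / real (card (pulls k t w)))" for k
    have mean: "\<bar>(\<Sum>s\<in>pulls k t w. w (k, s)) / real (card (pulls k t w)) - arm_mean D k (Suc t)\<bar> < r k"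
      if "k < N" "pulls k t w \<noteq> {}" for k
    proof -
      define n where "n = real (card (pulls k t w))"
      have "n > 0"
        using that by (simp add: n_def card_gt_0_iff)
      have "deviation k t w = (\<Sum>s\<in>pulls k t w. w (k, s) - arm_mean D k (Suc t))"
        unfolding deviation_def using const that by (intro sum.cong) (auto simp: pulls_def)
      also have "\<dots> = (\<Sum>s\<in>pulls k t w. w (k, s)) - n * arm_mean D k (Suc t)"
        by (simp add: sum_subtractf n_def)
      finally have "(\<Sum>s\<in>pulls k t w. w (k, s)) / n - arm_mean D k (Suc t) = deviation k t w / n"
        using \<open>n > 0\<close> by (simp add: diff_divide_distrib)
      moreover have "\<bar>deviation k t w\<bar> < sqrt (A * n)"
        using accurate that by (auto simp: misestimated_def A_def n_def not_le)
      then have "\<bar>deviation k t w / n\<bar> < sqrt (A * n) / n"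
        using \<open>n > 0\<close> by (simp add: divide_strict_right_mono)
      moreover have "sqrt (A * n) / n = sqrt (A / n)"
        using \<open>n > 0\<close> by (simp add: real_sqrt_mult real_sqrt_divide real_div_sqrt field_simps)
      ultimately show ?thesis
        by (simp add: r_def n_def)
    qed
    have "(\<Sum>s\<in>pulls i t w. w (i, s)) / real (card (pulls i t w)) + r i
        \<le> (\<Sum>s\<in>pulls j t w. w (j, s)) / real (card (pulls j t w)) + r j"
      using index False i_nonempty by (simp add: index_def r_def A_def)
    then have "Delta < 2 * r j"
      using mean[OF j False] mean[OF \<open>i < N\<close> i_nonempty] gap[folded j_def] unfolding abs_less_iff by linarith
    then have "Delta\<^sup>2 \<le> (2 * r j)\<^sup>2"
      using \<open>Delta > 0\<close> by (intro power_mono) auto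
    also have "\<dots> = 4 * A / real (card (pulls j t w))"
      using A by (simp add: r_def power_mult_distrib)
    finally show ?thesis
      using \<open>Delta > 0\<close> False by (simp add: field_simps card_gt_0_iff)
  qed
  then show thesis
    by (intro few_pulls) (simp only: j_def A_def mult.assoc)
qed (rule misestimated)

text \<open>After the first \<open>N\<close> rounds, an intact window and an arm other than
  \<open>i\<close> meet \<open>suboptimal_pull_cases\<close>. Enlarging \<open>ln t\<close> to
  \<open>ln T\<close> gives one threshold \<open>L\<close> for all rounds up to the horizon.\<close>

lemma regret_at_cases:
  assumes "Delta > 0" "t < T"
    and gap: "\<exists>i<N. \<forall>j<N. j \<noteq> i \<longrightarrow> arm_mean D j (Suc t) + Delta \<le> arm_mean D i (Suc t)"
    and L: "L = 4 * (1 + alpha) * ln (real T) / Delta\<^sup>2"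
  obtains (optimal) "regret_at w (Suc t) = 0"
    | (initial) "t < N"
    | (broken) "t \<in> broken T"
    | (misestimated) "1 \<le> t" "misestimated t w"
    | (sparse) j where "j < N" "Suc t \<in> sparse_pulls L j w"
proof -
  obtain i where i: "i < N" "\<And>j. j < N \<Longrightarrow> j \<noteq> i \<Longrightarrow> arm_mean D j (Suc t) + Delta \<le> arm_mean D i (Suc t)"
    using gap by blast
  let ?j = "arm w (Suc t)"
  have j: "?j < N"
    by (simp add: arm_less)
  consider "?j = i" | "t < N" | "t \<in> broken T" | "?j \<noteq> i" "N \<le> t" "t \<notin> broken T"
    by linarith
  then show thesis
  proof cases
    case 1
    have "arm_mean D j (Suc t) \<le> arm_mean D i (Suc t)" if "j < N" for j
      using i(2)[OF that] \<open>Delta > 0\<close> by (cases "j = i") auto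
    then show thesis
      using 1 i(1) by (intro optimal) (simp add: regret_at_def Max_mean_eq)
  next
    case 4
    have t: "1 \<le> t" "t \<in> {1..<T}"
      using 4 N_pos \<open>t < T\<close> by simp_all
    then have "mean_vector s = mean_vector (Suc t)" if "s \<in> window t" for s
      using 4(3) that unfolding broken_def by blast
    then have const: "arm_mean D k s = arm_mean D k (Suc t)" if "k < N" "s \<in> window t" for k s
      using that unfolding mean_vector_eq_iff by blast
    show thesis
    proof (rule suboptimal_pull_cases[OF 4(2) \<open>Delta > 0\<close> i(1) i(2)[OF j 4(1)] const])
      assume "misestimated t w"
      with t show thesis
        by (intro misestimated)
    next
      assume "real (card (pulls ?j t w)) \<le> 4 * (1 + alpha) * ln (real t) / Delta\<^sup>2"
      also have "\<dots> \<le> L"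
        unfolding L using t \<open>t < T\<close> alpha_pos by (intro divide_right_mono mult_left_mono) auto
      finally show thesis
        using j 4(2) by (intro sparse[of ?j]) (auto simp: sparse_pulls_def)
    qed
  qed (rule initial broken; assumption)+
qed

text \<open>A pathwise bound: the regret of a round is at most 1 and is dominated by the indicators
  of the bad cases. The only random quantity left on the right is the number of
  misestimations.\<close>

lemma regret_path_le:
  assumes "Delta > 0" "T \<ge> 1"
    and gap: "\<And>t. t \<ge> 1 \<Longrightarrow> \<exists>i<N. \<forall>j<N. j \<noteq> i \<longrightarrow> arm_mean D j t + Delta \<le> arm_mean D i t"
    and L: "L = 4 * (1 + alpha) * ln (real T) / Delta\<^sup>2"
  shows "(\<Sum>t=1..T. regret_at w t) \<le> real N + real (card (broken T))
    + (\<Sum>t\<in>{1..<T}. of_bool (misestimated t w))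
    + real N * ((L + 1) * real T powr (1 - alpha) / (min lam 1 / 4))"
proof -
  \<comment> \<open>After this shift \<open>t\<close> is the end of the window and
    \<open>Suc t\<close> the round.\<close>
  have "(\<Sum>t=1..T. regret_at w t) = (\<Sum>t<T. regret_at w (Suc t))"
    by (simp add: sum.atLeast1_atMost_eq)
  also have "\<dots> \<le> (\<Sum>t<T. of_bool (t < N) + of_bool (t \<in> broken T)
      + of_bool (1 \<le> t \<and> misestimated t w) + (\<Sum>j<N. of_bool (Suc t \<in> sparse_pulls L j w)))"
  proof (rule sum_mono)
    fix t assume "t \<in> {..<T}"
    then have "t < T"
      by simp
    let ?a = "of_bool (t < N) :: real" and ?b = "of_bool (t \<in> broken T) :: real"
      and ?c = "of_bool (1 \<le> t \<and> misestimated t w) :: real"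
      and ?d = "\<Sum>j<N. of_bool (Suc t \<in> sparse_pulls L j w) :: real"
    have nonneg: "0 \<le> ?a" "0 \<le> ?b" "0 \<le> ?c" "0 \<le> ?d"
      by (simp_all add: sum_nonneg)
    have le_1: "regret_at w (Suc t) \<le> 1"
      by (simp add: regret_at_bounds)
    show "regret_at w (Suc t) \<le> ?a + ?b + ?c + ?d"
    proof (cases rule: regret_at_cases[OF \<open>Delta > 0\<close> \<open>t < T\<close> gap L, of w, case_names _ optimal initial broken misestimated sparse])
      case optimal
      then show ?thesis
        using nonneg by linarith
    next
      case initial
      then have "?a = 1"
        by simp
      then show ?thesis
        using le_1 nonneg by linarith
    next
      case broken
      then have "?b = 1"
        by simp
      then show ?thesis
        using le_1 nonneg by linarith
    next
      case misestimated
      then have "?c = 1"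
        by simp
      then show ?thesis
        using le_1 nonneg by linarith
    next
      case (sparse j)
      then have "1 \<le> ?d"
        using member_le_sum[of j "{..<N}" "\<lambda>j. of_bool (Suc t \<in> sparse_pulls L j w) :: real"] by simp
      then show ?thesis
        using le_1 nonneg by linarith
    qed simp
  qed
  also have "\<dots> = (\<Sum>t<T. of_bool (t < N)) + (\<Sum>t<T. of_bool (t \<in> broken T))
      + (\<Sum>t<T. of_bool (1 \<le> t \<and> misestimated t w))
      + (\<Sum>j<N. \<Sum>t<T. of_bool (Suc t \<in> sparse_pulls L j w))"
    by (simp only: sum.distrib sum.swap[where A = "{..<N}" and B = "{..<T}"])
  also have "(\<Sum>t<T. of_bool (t < N)) \<le> real N"
  proof -
    have "(\<Sum>t<T. of_bool (t < N)) = real (card ({..<T} \<inter> {t. t < N}))"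
      by simp
    also have "\<dots> \<le> real (card {..<N})"
      by (intro of_nat_mono card_mono) auto
    finally show ?thesis by simp
  qed
  also have "(\<Sum>t<T. of_bool (t \<in> broken T)) = real (card (broken T))"
  proof -
    have "{..<T} \<inter> {t. t \<in> broken T} = broken T"
      by (auto simp: broken_def)
    then show ?thesis by simp
  qed
  also have "(\<Sum>t<T. of_bool (1 \<le> t \<and> misestimated t w)) = (\<Sum>t\<in>{1..<T}. of_bool (misestimated t w) :: real)"
    by (intro sum.mono_neutral_cong_right) auto
  also have "(\<Sum>j<N. \<Sum>t<T. of_bool (Suc t \<in> sparse_pulls L j w))
      \<le> (\<Sum>j<N. (L + 1) * real T powr (1 - alpha) / (min lam 1 / 4))"
  proof (rule sum_mono)
    fix j
    have "L \<ge> 0"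
      unfolding L using \<open>T \<ge> 1\<close> alpha_pos by simp
    have "(\<Sum>t<T. of_bool (Suc t \<in> sparse_pulls L j w)) = real (card ({..<T} \<inter> {t. Suc t \<in> sparse_pulls L j w}))"
      by simp
    also have "\<dots> \<le> real (card (sparse_pulls L j w \<inter> {..T}))"
      by (intro of_nat_mono card_inj_on_le[where f = Suc]) auto
    also have "\<dots> \<le> (L + 1) * real T powr (1 - alpha) / (min lam 1 / 4)"
      by (rule card_sparse_pulls_le[OF \<open>L \<ge> 0\<close>])
    finally show "(\<Sum>t<T. of_bool (Suc t \<in> sparse_pulls L j w)) \<le> (L + 1) * real T powr (1 - alpha) / (min lam 1 / 4)" .
  qed
  finally show ?thesis
    by simp
qed

text \<open>Taking expectations turns the number of misestimations into a sum of probabilities,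
  bounded by a harmonic sum.\<close>

lemma sw_regret_le:
  assumes "Delta > 0" "T \<ge> 1"
    and gap: "\<And>t. t \<ge> 1 \<Longrightarrow> \<exists>i<N. \<forall>j<N. j \<noteq> i \<longrightarrow> arm_mean D j t + Delta \<le> arm_mean D i t"
    and L: "L = 4 * (1 + alpha) * ln (real T) / Delta\<^sup>2"
  shows "sw_regret N lam alpha sel D T \<le> real N
    + real (num_breakpoints N (arm_mean D) T) * (lam * real T powr alpha + 1)
    + 2 * real N * (1 + ln (real T))
    + real N * ((L + 1) * real T powr (1 - alpha) / (min lam 1 / 4))"
proof -
  interpret P: prob_space "reward_space N D"
    by (rule prob_space_reward_space)
  define R where "R = real N * ((L + 1) * real T powr (1 - alpha) / (min lam 1 / 4))"
  let ?mis = "\<lambda>t. {w \<in> space (reward_space N D). misestimated t w}"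
  have int_mis: "integrable (reward_space N D) (\<lambda>w. \<Sum>t\<in>{1..<T}. indicator (?mis t) w :: real)"
    by (intro Bochner_Integration.integrable_sum integrable_real_indicator) (auto simp: P.emeasure_eq_measure)
  have "sw_regret N lam alpha sel D T = integral\<^sup>L (reward_space N D) (\<lambda>w. \<Sum>t=1..T. regret_at w t)"
    unfolding sw_regret_def regret_at_def[symmetric]
    by (intro Bochner_Integration.integral_sum[symmetric] regret_at_integrable) auto
  also have "\<dots> \<le> integral\<^sup>L (reward_space N D) (\<lambda>w. real N + real (card (broken T)) + R
      + (\<Sum>t\<in>{1..<T}. indicator (?mis t) w))"
  proof (rule integral_mono)
    show "integrable (reward_space N D) (\<lambda>w. \<Sum>t=1..T. regret_at w t)"
      by (intro Bochner_Integration.integrable_sum regret_at_integrable) auto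
    show "integrable (reward_space N D) (\<lambda>w. real N + real (card (broken T)) + R
        + (\<Sum>t\<in>{1..<T}. indicator (?mis t) w))"
      using int_mis by simp
    fix w assume "w \<in> space (reward_space N D)"
    then have "(\<Sum>t\<in>{1..<T}. of_bool (misestimated t w)) = (\<Sum>t\<in>{1..<T}. indicator (?mis t) w :: real)"
      by (intro sum.cong) (auto simp: indicator_def)
    then show "(\<Sum>t=1..T. regret_at w t)
        \<le> real N + real (card (broken T)) + R + (\<Sum>t\<in>{1..<T}. indicator (?mis t) w)"
      using regret_path_le[OF assms, of w] by (simp add: R_def)
  qed
  also have "\<dots> = real N + real (card (broken T)) + R + (\<Sum>t\<in>{1..<T}. measure (reward_space N D) (?mis t))"
  proof -
    have "integral\<^sup>L (reward_space N D) (\<lambda>w. \<Sum>t\<in>{1..<T}. indicator (?mis t) w :: real) = (\<Sum>t\<in>{1..<T}. measure (reward_space N D) (?mis t))"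
      by (subst Bochner_Integration.integral_sum) (auto simp: P.emeasure_eq_measure)
    then show ?thesis
      using int_mis by (simp add: P.prob_space)
  qed
  also have "(\<Sum>t\<in>{1..<T}. measure (reward_space N D) (?mis t)) \<le> (\<Sum>t\<in>{1..<T}. 2 * real N / real t)"
    by (intro sum_mono prob_misestimated_le) auto
  also have "\<dots> \<le> (\<Sum>t=1..T. 2 * real N / real t)"
    by (intro sum_mono2) auto
  also have "\<dots> = 2 * real N * (\<Sum>t=1..T. 1 / real t)"
    by (simp add: sum_distrib_left)
  also have "\<dots> \<le> 2 * real N * (1 + ln (real T))"
    using sum_inverse_le_ln[OF \<open>T \<ge> 1\<close>] by (intro mult_left_mono) auto
  finally show ?thesis
    using card_broken_le[of T] by (simp add: R_def)
qed

end

text \<open>All terms are absorbed into the product of \<open>T powr (1 - alpha)\<close> and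
  \<open>ln T\<close>, since for \<open>T \<ge> 2\<close> these factors are at least 1 and 1/2. The
  constant is obtained before \<open>D\<close>, \<open>sel\<close> and \<open>T\<close>, hence
  uniform in them.\<close>

lemma sw_regret_constant:
  fixes N :: nat and lam alpha nu C Delta :: real
  assumes "lam > 0" and alpha: "0 < alpha" "alpha \<le> 1 / 2" and nu: "nu + alpha = 1 - alpha"
    and "C > 0" "Delta > 0"
  obtains K where "\<And>D sel T. sw_ucb N lam alpha sel D \<Longrightarrow>
      real (num_breakpoints N (arm_mean D) T) \<le> C * real T powr nu \<Longrightarrow>
      (\<And>t. t \<ge> 1 \<Longrightarrow> \<exists>i<N. \<forall>j<N. j \<noteq> i \<longrightarrow> arm_mean D j t + Delta \<le> arm_mean D i t) \<Longrightarrow>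
      T \<ge> 2 \<Longrightarrow> sw_regret N lam alpha sel D T \<le> K * real T powr (1 - alpha) * ln (real T)"
proof -
  \<comment> \<open>With \<open>4 * (1 + alpha) \<le> 6\<close> and \<open>1 \<le> 2 * ln T\<close>,
    this gives \<open>L + 1 \<le> q * ln T\<close>. Below, \<open>c\<close> is the gain from
    \<open>powr_window_gain\<close>.\<close>
  define q where "q = 6 / Delta\<^sup>2 + 2"
  define c where "c = min lam 1 / 4"
  \<comment> \<open>The summands pay, in order, for the initial rounds, the broken windows, the
    misestimations and the sparse pulls.\<close>
  define K where "K = 2 * real N + 2 * (C * (lam + 1)) + 6 * real N + real N * (q / c)"
  have "sw_regret N lam alpha sel D T \<le> K * real T powr (1 - alpha) * ln (real T)"
    if sw_ucb: "sw_ucb N lam alpha sel D"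
      and breaks: "real (num_breakpoints N (arm_mean D) T) \<le> C * real T powr nu"
      and gap: "\<And>t. t \<ge> 1 \<Longrightarrow> \<exists>i<N. \<forall>j<N. j \<noteq> i \<longrightarrow> arm_mean D j t + Delta \<le> arm_mean D i t"
      and "T \<ge> 2" for D sel and T :: nat
  proof -
    interpret sw_ucb N lam alpha sel D
      by (rule sw_ucb)
    define L where "L = 4 * (1 + alpha) * ln (real T) / Delta\<^sup>2"
    define p where "p = real T powr (1 - alpha)"
    define l where "l = ln (real T)"
    have "ln 2 \<le> l"
      using \<open>T \<ge> 2\<close> by (simp add: l_def)
    then have l: "1 / 2 \<le> l"
      using ln2_ge_two_thirds by simp
    have p: "1 \<le> p"
      using \<open>T \<ge> 2\<close> alpha by (simp add: p_def ge_one_powr_ge_zero)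
    have "l \<le> p * l"
      using p l mult_right_mono[of 1 p l] by simp
    have "p \<le> 2 * (p * l)"
      using p l mult_left_mono[of "1 / 2" l p] by simp
    have "sw_regret N lam alpha sel D T \<le> real N
      + real (num_breakpoints N (arm_mean D) T) * (lam * real T powr alpha + 1)
      + 2 * real N * (1 + l) + real N * ((L + 1) * p / c)"
      using sw_regret_le[of Delta T L] gap \<open>Delta > 0\<close> \<open>T \<ge> 2\<close>
      by (simp add: L_def p_def l_def c_def)
    moreover have "real N \<le> 2 * real N * (p * l)"
      using mult_left_mono[of 1 "2 * (p * l)" "real N"] p \<open>p \<le> 2 * (p * l)\<close> by simp
    moreover have "real (num_breakpoints N (arm_mean D) T) * (lam * real T powr alpha + 1)
        \<le> 2 * (C * (lam + 1)) * (p * l)"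
    proof -
      have "1 \<le> real T powr alpha"
        using \<open>T \<ge> 2\<close> alpha by (simp add: ge_one_powr_ge_zero)
      then have "lam * real T powr alpha + 1 \<le> (lam + 1) * real T powr alpha"
        by (simp add: algebra_simps)
      then have "real (num_breakpoints N (arm_mean D) T) * (lam * real T powr alpha + 1)
          \<le> (C * real T powr nu) * ((lam + 1) * real T powr alpha)"
        using breaks \<open>T \<ge> 2\<close> \<open>C > 0\<close> \<open>lam > 0\<close> by (intro mult_mono) auto
      \<comment> \<open>The choice of \<open>alpha\<close> enters here:
        \<open>nu + alpha = 1 - alpha\<close> gives the breakpoint term the same order as the sparse
        pulls.\<close>
      also have "\<dots> = C * (lam + 1) * p"
        by (simp add: p_def powr_add flip: nu)
      also have "\<dots> \<le> C * (lam + 1) * (2 * (p * l))"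
        using \<open>p \<le> 2 * (p * l)\<close> \<open>C > 0\<close> \<open>lam > 0\<close> by (intro mult_left_mono) auto
      finally show ?thesis
        by (simp only: mult_ac)
    qed
    moreover have "2 * real N * (1 + l) \<le> 6 * real N * (p * l)"
    proof -
      have "1 + l \<le> 3 * (p * l)"
        using l \<open>l \<le> p * l\<close> by linarith
      have "2 * real N * (1 + l) \<le> 2 * real N * (3 * (p * l))"
        using \<open>1 + l \<le> 3 * (p * l)\<close> by (intro mult_left_mono) auto
      then show ?thesis by simp
    qed
    moreover have "real N * ((L + 1) * p / c) \<le> real N * (q / c) * (p * l)"
    proof -
      have "4 * (1 + alpha) * l / Delta\<^sup>2 \<le> 6 * l / Delta\<^sup>2"
        using alpha l by (intro divide_right_mono mult_right_mono) auto
      then have "L + 1 \<le> q * l"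
        using l by (simp add: L_def q_def l_def distrib_right)
      then have "real N * ((L + 1) * p / c) \<le> real N * (q * l * p / c)"
        using p \<open>lam > 0\<close> by (intro mult_left_mono divide_right_mono mult_right_mono) (auto simp: c_def)
      then show ?thesis
        by (simp add: mult_ac)
    qed
    moreover have "K * p * l = 2 * real N * (p * l) + 2 * (C * (lam + 1)) * (p * l)
        + 6 * real N * (p * l) + real N * (q / c) * (p * l)"
      by (simp only: K_def distrib_right mult.assoc)
    ultimately show ?thesis
      unfolding p_def[symmetric] l_def[symmetric] by linarith
  qed
  then show thesis
    by (rule that)
qed

text \<open>\<open>K\<close> is quantified before \<open>D\<close> and \<open>sel\<close>, so one
  constant serves all environments and tie-breaking rules. The range \<open>T \<ge> 2\<close> keeps
  \<open>ln T\<close> positive.\<close>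

theorem theorem3:
  fixes N :: nat and nu C lam Delta :: real
  assumes "N \<ge> 1" and "0 \<le> nu" and "nu < 1" and "C > 0" and "lam > 0" and "Delta > 0"
  shows "\<exists>K. \<forall>D sel.
     (\<forall>j<N. \<forall>t. prob_space (D j t) \<and> sets (D j t) = sets borel
                \<and> (AE x in D j t. 0 \<le> x \<and> x \<le> 1)) \<longrightarrow>
     (\<forall>T\<ge>1. real (num_breakpoints N (arm_mean D) T) \<le> C * real T powr nu) \<longrightarrow>
     (\<forall>t\<ge>1. \<exists>i<N. \<forall>j<N. j \<noteq> i \<longrightarrow> arm_mean D j t + Delta \<le> arm_mean D i t) \<longrightarrow>
     (\<forall>t h S. S \<noteq> {} \<longrightarrow> sel t h S \<in> S) \<longrightarrow>
     (\<forall>t\<ge>1. (\<lambda>w. sw_arm N lam ((1 - nu) / 2) sel w t)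
               \<in> measurable (reward_space N D) (count_space UNIV)) \<longrightarrow>
     (\<forall>T\<ge>2. sw_regret N lam ((1 - nu) / 2) sel D T
              \<le> K * real T powr ((1 + nu) / 2) * ln (real T))"
proof -
  define alpha where "alpha = (1 - nu) / 2"
  have alpha: "0 < alpha" "alpha \<le> 1 / 2" and nu: "nu + alpha = 1 - alpha" and beta: "(1 + nu) / 2 = 1 - alpha"
    using assms by (auto simp: alpha_def field_simps)
  obtain K where K: "\<And>D sel T. sw_ucb N lam alpha sel D \<Longrightarrow>
      real (num_breakpoints N (arm_mean D) T) \<le> C * real T powr nu \<Longrightarrow>
      (\<And>t. t \<ge> 1 \<Longrightarrow> \<exists>i<N. \<forall>j<N. j \<noteq> i \<longrightarrow> arm_mean D j t + Delta \<le> arm_mean D i t) \<Longrightarrow>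
      T \<ge> 2 \<Longrightarrow> sw_regret N lam alpha sel D T \<le> K * real T powr (1 - alpha) * ln (real T)"
    using sw_regret_constant[OF \<open>lam > 0\<close> alpha nu \<open>C > 0\<close> \<open>Delta > 0\<close>] by blast
  have "sw_regret N lam alpha sel D T \<le> K * real T powr (1 - alpha) * ln (real T)"
    if D: "\<forall>j<N. \<forall>t. prob_space (D j t) \<and> sets (D j t) = sets borel
                \<and> (AE x in D j t. 0 \<le> x \<and> x \<le> 1)"
      and breaks: "\<forall>T\<ge>1. real (num_breakpoints N (arm_mean D) T) \<le> C * real T powr nu"
      and gap: "\<forall>t\<ge>1. \<exists>i<N. \<forall>j<N. j \<noteq> i \<longrightarrow> arm_mean D j t + Delta \<le> arm_mean D i t"
      and sel: "\<forall>t h S. S \<noteq> {} \<longrightarrow> sel t h S \<in> S"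
      and meas: "\<forall>t\<ge>1. (\<lambda>w. sw_arm N lam alpha sel w t)
               \<in> measurable (reward_space N D) (count_space UNIV)"
      and "T \<ge> 2" for D sel and T :: nat
  proof (rule K)
    show "sw_ucb N lam alpha sel D"
      by (rule sw_ucb.intro; (rule assms alpha sel[rule_format] meas[rule_format] | use D in blast); assumption?)
  qed (use breaks gap \<open>T \<ge> 2\<close> in simp_all)
  then show ?thesis
    unfolding beta alpha_def[symmetric] by (intro exI[of _ K] allI impI)
qed

end
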